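(* Fix $\rho>0$ and a rooted tree network with buses $\mathcal{N}=\{0,\dots,n\}$, phase sets $\Phi_i\subseteq\{a,b,c\}$, cost functions $f_i^\phi:\mathbb{C}\to\mathbb{R}$, injection regions $\mathcal{I}_i^\phi\subseteq\mathbb{C}$ and voltage bounds $\underline v_i^\phi\le\overline v_i^\phi$, as described in the context. Suppose that for all $i\in\mathcal{N}$ and $\phi\in\Phi_i$ there exists a closed form solution to the optimization problem $$\min_{s\in\mathcal{I}_i^\phi}\ f_i^\phi(s)+\frac{\rho}{2}\,|s-\hat s|^2$$ for any given constants $\hat s\in\mathbb{C}$ and $\rho$. Then, for every bus $i\in\mathcal{N}$ and for any given values of the constants $y_{ij},\mu_{ij}$ $(j\in N_i)$ and $\lambda_{i1}$, the subproblems of the ADMM $x$-update for the relaxed optimal power flow problem, namely $$\min_{x_{i0}\in\mathcal{K}_{i0}} H_{i0}(x_{i0})\qquad\text{and}\qquad \min_{x_{i1}\in\mathcal{K}_{i1}} H_{i1}(x_{i1}),$$ with $H_{i0},H_{i1},\mathcal{K}_{i0},\mathcal{K}_{i1}$ as defined in the context, can be solved via either closed form solutions or eigen-decomposition of a $6\times 6$ Hermitian matrix.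
   Context: Notation. $\langle x,y\rangle:=\mathrm{Re}(\mathrm{tr}(x^Hy))$ and $\|x\|_2:=\sqrt{\langle x,x\rangle}$ for complex matrices or vectors of equal size (Frobenius/Euclidean norm). $\mathbb{S}_+$ is the set of Hermitian positive semidefinite matrices (of the appropriate size). Network. $\mathcal{N}=\{0,1,\dots,n\}$ is the vertex set of a tree rooted at $0$. Each $i\ne 0$ has a unique parent (ancestor) $A_i$, and $C_i$ is the set of children of $i$. $N_i:=\{i\}\cup\{A_i\}\cup C_i$ (with $A_i$ omitted when $i=0$). Each bus has a set of phases $\Phi_i\subseteq\{a,b,c\}$, with $\Phi_i\subseteq\Phi_{A_i}$ for $i\neq 0$. For each $i\in\mathcal{N}$ and $\phi\in\Phi_i$, $f_i^\phi:\mathbb{C}\to\mathbb{R}$ is a convex function, $\mathcal{I}_i^\phi\subseteq\mathbb{C}$ is a convex set, and $\underline v_i^\phi\le\overline v_i^\phi$ are real bounds. Write $f_i(s_i):=\sum_{\phi\in\Phi_i}f_i^\phi(s_i^\phi)$ for $s_i=(s_i^\phi)_{\phi\in\Phi_i}\in\mathbb{C}^{|\Phi_i|}$. Variables. For each bus $i$, $x_{i0}=(S_{i0},\ell_{i0},v_{i0},s_{i0})$, where $S_{i0}\in\mathbb{C}^{|\Phi_i|\times|\Phi_i|}$, $\ell_{i0}$ and $v_{i0}$ are Hermitian matrices in $\mathbb{C}^{|\Phi_i|\times|\Phi_i|}$, and $s_{i0}\in\mathbb{C}^{|\Phi_i|}$; and $x_{i1}=v_{i1}\in\mathbb{C}^{|\Phi_i|\times|\Phi_i|}$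 is Hermitian. The variables $S_{i0},\ell_{i0}$ are attached to the line from $i$ to $A_i$, so for the root $i=0$ they are absent (all terms containing them are dropped, and the block matrix below reduces to $v_{00}$). The diagonal entry of a matrix $v$ in phase $\phi$ is written $v^{\phi\phi}$. Given constants (of the same matrix types as the corresponding variables; $v$- and $\ell$-type entries Hermitian): - $y_{ii}=(S_{ii},\ell_{ii},v_{ii},s_{ii})$; $y_{iA_i}=(S_{iA_i},\ell_{iA_i})$; $y_{ij}=(v_{ij})$ for $j\in C_i$; - multipliers $\mu_{ij}$ with the same components as $y_{ij}$, and $\lambda_{i1}$ with the same shape as $v_{i1}$. In $\langle\mu_{ij},x_{i0}\rangle$ and $x_{i0}-y_{ij}$, only the components of $x_{i0}$ that also appear in $y_{ij}$ are used. Weighted norms: $$\|x_{i0}-y_{ij}\|_{M_{ij}}^2=\begin{cases}(2|C_i|+3)\|S_{i0}-S_{ii}\|_2^2+\|s_{i0}-s_{ii}\|_2^2+2\|v_{i0}-v_{ii}\|_2^2+(|C_i|+1)\|\ell_{i0}-\ell_{ii}\|_2^2 & j=i\\ \|S_{i0}-S_{iA_i}\|_2^2+\|\ell_{i0}-\ell_{iA_i}\|_2^2 & j=A_i\\ \|v_{i0}-v_{ij}\|_2^2 & j\in C_i.\end{cases}$$ Objectives: $$H_{i0}(x_{i0})=f_i(s_{i0})+\sum_{j\in N_i}\Big(\langle\mu_{ij},x_{i0}\rangle+\frac{\rho}{2}\|x_{i0}-y_{ij}\|_{M_{ij}}^2\Big),\qquad H_{i1}(x_{i1})=\langle\lambda_{i1},v_{i1}\rangle+\frac{\rho}{2}\|v_{i1}-v_{ii}\|_2^2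 .$$ Feasible sets: $$\mathcal{K}_{i0}=\Big\{x_{i0}:\ \begin{pmatrix}v_{i0}&S_{i0}\\ S_{i0}^H&\ell_{i0}\end{pmatrix}\in\mathbb{S}_+,\ s_{i0}^\phi\in\mathcal{I}_i^\phi\ \text{for all }\phi\in\Phi_i\Big\},\qquad \mathcal{K}_{i1}=\{v_{i1}:\ \underline v_i^\phi\le v_{i1}^{\phi\phi}\le\overline v_i^\phi\ \text{for all }\phi\in\Phi_i\}.$$ Meaning of the conclusion. "Solved via closed form solutions or eigen-decomposition" means that a minimizer is obtained from the given constants by explicit formulas (arithmetic operations, minima and maxima), applications of the assumed closed form solutions of the scalar problems over $\mathcal{I}_i^\phi$, and eigen-decomposition (eigenvalues and orthonormal eigenvectors) of a Hermitian matrix. The size $6\times 6$ corresponds to the block matrix $\begin{pmatrix}v_{i0}&S_{i0}\\ S_{i0}^H&\ell_{i0}\end{pmatrix}$ for a three-phase bus; a bus with fewer phases gives the smaller size $2|\Phi_i|$ (for the root, $|\Phi_0|$), viewed as a zero-padded $6\times 6$ matrix. *)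

theory Defs
  imports "HOL-Analysis.Analysis"
begin

section \<open>Phases and complex matrices\<close>

datatype phase = Ph_a | Ph_b | Ph_c

instance phase :: finite
proof
  have "(UNIV :: phase set) = {Ph_a, Ph_b, Ph_c}"
    using phase.exhaust by auto
  then show "finite (UNIV :: phase set)"
    by (metis finite.emptyI finite.insertI)
qed

text \<open>
  A matrix over \<open>P \<times> P\<close> with \<open>P\<close> a set of phases is represented by its zero-padded
  \<open>3 \<times> 3\<close> matrix, i.e. entries outside \<open>P \<times> P\<close> vanish; similarly for vectors. Inner products,
  norms, Hermitian symmetry and positive semidefiniteness are unaffected by the padding.
  The \<open>6 \<times> 6\<close> matrices are indexed by \<open>phase + phase\<close>.
\<close>

type_synonym cmat = "complex^phase^phase"
type_synonym cvec = "complex^phase"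
type_synonym cmat6 = "complex^(phase + phase)^(phase + phase)"

definition adj :: "complex^'n^'m \<Rightarrow> complex^'m^'n" where
  "adj X = (\<chi> i j. cnj (X $ j $ i))"

text \<open>The inner product \<open>Re (tr (x\<^sup>H y))\<close> is the library's real inner product, and the library's
  norm on \<open>complex^'n^'m\<close> is the Frobenius norm.\<close>

lemma inner_eq_Re_trace:
  fixes X Y :: "complex^'n^'m"
  shows "X \<bullet> Y = Re (trace (adj X ** Y))"
proof -
  have "X \<bullet> Y = (\<Sum>i\<in>UNIV. \<Sum>j\<in>UNIV. Re (cnj (X $ i $ j) * Y $ i $ j))"
    by (simp add: inner_vec_def inner_complex_def)
  also have "\<dots> = (\<Sum>j\<in>UNIV. \<Sum>i\<in>UNIV. Re (cnj (X $ i $ j) * Y $ i $ j))"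
    by (rule sum.swap)
  finally show ?thesis
    by (simp add: trace_def adj_def matrix_matrix_mult_def)
qed

lemma norm_eq_sqrt_Re_trace:
  fixes X :: "complex^'n^'m"
  shows "norm X = sqrt (Re (trace (adj X ** X)))"
  by (simp add: norm_eq_sqrt_inner inner_eq_Re_trace)

definition hermitian :: "complex^'n^'n \<Rightarrow> bool" where
  "hermitian X \<longleftrightarrow> adj X = X"

text \<open>\<open>z \<bullet> (X *v z)\<close> is the real part of \<open>z\<^sup>H X z\<close>, which is real for Hermitian \<open>X\<close>.\<close>

definition psd :: "complex^'n^'n \<Rightarrow> bool" where
  "psd X \<longleftrightarrow> hermitian X \<and> (\<forall>z. 0 \<le> z \<bullet> (X *v z))"

text \<open>Real eigenvalues \<open>d\<close>; the columns of \<open>U\<close> are orthonormal eigenvectors.\<close>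

definition eigen_decomposition ::
    "complex^'n^'n \<Rightarrow> ('n \<Rightarrow> real) \<Rightarrow> complex^'n^'n \<Rightarrow> bool" where
  "eigen_decomposition X d U \<longleftrightarrow>
     adj U ** U = mat 1 \<and> (\<forall>k. X *v column k U = complex_of_real (d k) *s column k U)"

definition mats_on :: "phase set \<Rightarrow> cmat set" where
  "mats_on P = {X. \<forall>\<phi> \<psi>. \<phi> \<notin> P \<or> \<psi> \<notin> P \<longrightarrow> X $ \<phi> $ \<psi> = 0}"

definition herms_on :: "phase set \<Rightarrow> cmat set" where
  "herms_on P = {X \<in> mats_on P. hermitian X}"

definition vecs_on :: "phase set \<Rightarrow> cvec set" where
  "vecs_on P = {z. \<forall>\<phi>. \<phi> \<notin> P \<longrightarrow> z $ \<phi> = 0}"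

section \<open>The network\<close>

record net =
  last_bus :: nat
  parent :: "nat \<Rightarrow> nat"
  phases :: "nat \<Rightarrow> phase set"
  cost :: "nat \<Rightarrow> phase \<Rightarrow> complex \<Rightarrow> real"
  region :: "nat \<Rightarrow> phase \<Rightarrow> complex set"
  vmin :: "nat \<Rightarrow> phase \<Rightarrow> real"
  vmax :: "nat \<Rightarrow> phase \<Rightarrow> real"

definition buses :: "net \<Rightarrow> nat set" where
  "buses N = {0..last_bus N}"

definition children :: "net \<Rightarrow> nat \<Rightarrow> nat set" where
  "children N i = {j \<in> buses N. j \<noteq> 0 \<and> parent N j = i}"

definition nbrs :: "net \<Rightarrow> nat \<Rightarrow> nat set" where
  "nbrs N i = {i} \<union> (if i = 0 then {} else {parent N i}) \<union> children N i"

text \<open>The tree is given by its parent map; the value of the map at the root is irrelevant.\<close>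

definition rooted_tree :: "net \<Rightarrow> bool" where
  "rooted_tree N \<longleftrightarrow>
     (\<forall>i \<in> buses N - {0}. parent N i \<in> buses N \<and> (\<exists>k. (parent N ^^ k) i = 0))"

definition opf_net :: "net \<Rightarrow> bool" where
  "opf_net N \<longleftrightarrow>
     rooted_tree N \<and>
     (\<forall>i \<in> buses N - {0}. phases N i \<subseteq> phases N (parent N i)) \<and>
     (\<forall>i \<in> buses N. \<forall>\<phi> \<in> phases N i.
        convex_on UNIV (cost N i \<phi>) \<and> convex (region N i \<phi>) \<and> vmin N i \<phi> \<le> vmax N i \<phi>)"

section \<open>Variables and constants of the subproblems at a bus\<close>

text \<open>One record type holds \<open>x\<^sub>i\<^sub>0\<close> as well as all \<open>y\<^sub>i\<^sub>j\<close> and \<open>\<mu>\<^sub>i\<^sub>j\<close>; components that a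
  quantity does not have are set to zero.\<close>

record bus_var =
  Smat :: cmat
  lmat :: cmat
  vmat :: cmat
  svec :: cvec

definition line_phases :: "net \<Rightarrow> nat \<Rightarrow> phase set" where
  "line_phases N i = (if i = 0 then {} else phases N i)"

definition x0_space :: "net \<Rightarrow> nat \<Rightarrow> bus_var set" where
  "x0_space N i =
     {x. Smat x \<in> mats_on (line_phases N i) \<and> lmat x \<in> herms_on (line_phases N i) \<and>
         vmat x \<in> herms_on (phases N i) \<and> svec x \<in> vecs_on (phases N i)}"

definition y_space :: "net \<Rightarrow> nat \<Rightarrow> nat \<Rightarrow> bus_var set" where
  "y_space N i j =
     (if j = i then x0_space N i
      else if i \<noteq> 0 \<and> j = parent N i then {y \<in> x0_space N i. vmat y = 0 \<and> svec y = 0}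
      else {y \<in> x0_space N i. Smat y = 0 \<and> lmat y = 0 \<and> svec y = 0})"

text \<open>For a fixed bus \<open>i\<close>: \<open>cy c j\<close>, \<open>cmu c j\<close> and \<open>clam c\<close> are \<open>y\<^sub>i\<^sub>j\<close>, \<open>\<mu>\<^sub>i\<^sub>j\<close> and \<open>\<lambda>\<^sub>i\<^sub>1\<close>.\<close>

record adm_data =
  cy :: "nat \<Rightarrow> bus_var"
  cmu :: "nat \<Rightarrow> bus_var"
  clam :: cmat

definition const_space :: "net \<Rightarrow> nat \<Rightarrow> adm_data set" where
  "const_space N i =
     {c. (\<forall>j \<in> nbrs N i. cy c j \<in> y_space N i j \<and> cmu c j \<in> y_space N i j) \<and>
         clam c \<in> herms_on (phases N i)}"

section \<open>Objectives and feasible sets\<close>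

text \<open>In the two functions below \<open>j\<close> ranges over \<open>nbrs N i\<close>, so the last case is \<open>j \<in> children N i\<close>.
  For \<open>i = 0\<close> the terms in \<open>S\<close> and \<open>\<ell>\<close> are zero because these components are.\<close>

definition pairing :: "net \<Rightarrow> nat \<Rightarrow> nat \<Rightarrow> bus_var \<Rightarrow> bus_var \<Rightarrow> real" where
  "pairing N i j m x =
     (if j = i then
        Smat m \<bullet> Smat x + lmat m \<bullet> lmat x + vmat m \<bullet> vmat x + svec m \<bullet> svec x
      else if i \<noteq> 0 \<and> j = parent N i then Smat m \<bullet> Smat x + lmat m \<bullet> lmat x
      else vmat m \<bullet> vmat x)"

definition wdist2 :: "net \<Rightarrow> nat \<Rightarrow> nat \<Rightarrow> bus_var \<Rightarrow> bus_var \<Rightarrow> real" where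
  "wdist2 N i j x y =
     (if j = i then
        (2 * real (card (children N i)) + 3) * (norm (Smat x - Smat y))\<^sup>2
        + (norm (svec x - svec y))\<^sup>2
        + 2 * (norm (vmat x - vmat y))\<^sup>2
        + (real (card (children N i)) + 1) * (norm (lmat x - lmat y))\<^sup>2
      else if i \<noteq> 0 \<and> j = parent N i then
        (norm (Smat x - Smat y))\<^sup>2 + (norm (lmat x - lmat y))\<^sup>2
      else (norm (vmat x - vmat y))\<^sup>2)"

definition bus_cost :: "net \<Rightarrow> nat \<Rightarrow> cvec \<Rightarrow> real" where
  "bus_cost N i s = (\<Sum>\<phi> \<in> phases N i. cost N i \<phi> (s $ \<phi>))"

definition H0 :: "net \<Rightarrow> real \<Rightarrow> nat \<Rightarrow> adm_data \<Rightarrow> bus_var \<Rightarrow> real" where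
  "H0 N \<rho> i c x =
     bus_cost N i (svec x)
     + (\<Sum>j \<in> nbrs N i. pairing N i j (cmu c j) x + \<rho> / 2 * wdist2 N i j x (cy c j))"

definition H1 :: "net \<Rightarrow> real \<Rightarrow> nat \<Rightarrow> adm_data \<Rightarrow> cmat \<Rightarrow> real" where
  "H1 N \<rho> i c v = clam c \<bullet> v + \<rho> / 2 * (norm (v - vmat (cy c i)))\<^sup>2"

definition block :: "cmat \<Rightarrow> cmat \<Rightarrow> cmat \<Rightarrow> cmat6" where
  "block v S l =
     (\<chi> p q. case p of
        Inl \<phi> \<Rightarrow> (case q of Inl \<psi> \<Rightarrow> v $ \<phi> $ \<psi> | Inr \<psi> \<Rightarrow> S $ \<phi> $ \<psi>)
      | Inr \<phi> \<Rightarrow> (case q of Inl \<psi> \<Rightarrow> adj S $ \<phi> $ \<psi> | Inr \<psi> \<Rightarrow> l $ \<phi> $ \<psi>))"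

definition K0 :: "net \<Rightarrow> nat \<Rightarrow> bus_var set" where
  "K0 N i =
     {x \<in> x0_space N i. psd (block (vmat x) (Smat x) (lmat x)) \<and>
        (\<forall>\<phi> \<in> phases N i. svec x $ \<phi> \<in> region N i \<phi>)}"

definition K1 :: "net \<Rightarrow> nat \<Rightarrow> cmat set" where
  "K1 N i =
     {v \<in> herms_on (phases N i).
        \<forall>\<phi> \<in> phases N i. vmin N i \<phi> \<le> Re (v $ \<phi> $ \<phi>) \<and> Re (v $ \<phi> $ \<phi>) \<le> vmax N i \<phi>}"

section \<open>Closed forms and eigen-decomposition\<close>

text \<open>
  Explicit formulas: arithmetic on complex numbers, minima and maxima (of real parts), and calls
  of the given solvers of the scalar problems. Literals are rational, so that real data can enter a
  formula only through its inputs.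
\<close>

datatype 'a formula =
    Lit rat
  | Input 'a
  | Plus "'a formula" "'a formula"
  | Minus "'a formula" "'a formula"
  | Times "'a formula" "'a formula"
  | Divide "'a formula" "'a formula"
  | Conj "'a formula"
  | Minimum "'a formula" "'a formula"
  | Maximum "'a formula" "'a formula"
  | Solve phase "'a formula" "'a formula"

text \<open>\<open>P \<phi> r t\<close> is the value of the solver for phase \<open>\<phi>\<close> at penalty \<open>r\<close> and centre \<open>t\<close>.\<close>

primrec formula_val ::
    "(phase \<Rightarrow> real \<Rightarrow> complex \<Rightarrow> complex) \<Rightarrow> ('a \<Rightarrow> complex) \<Rightarrow> 'a formula \<Rightarrow> complex" where
  "formula_val P env (Lit q) = of_rat q"
| "formula_val P env (Input a) = env a"
| "formula_val P env (Plus e e') = formula_val P env e + formula_val P env e'"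
| "formula_val P env (Minus e e') = formula_val P env e - formula_val P env e'"
| "formula_val P env (Times e e') = formula_val P env e * formula_val P env e'"
| "formula_val P env (Divide e e') = formula_val P env e / formula_val P env e'"
| "formula_val P env (Conj e) = cnj (formula_val P env e)"
| "formula_val P env (Minimum e e') =
     complex_of_real (min (Re (formula_val P env e)) (Re (formula_val P env e')))"
| "formula_val P env (Maximum e e') =
     complex_of_real (max (Re (formula_val P env e)) (Re (formula_val P env e')))"
| "formula_val P env (Solve \<phi> e e') = P \<phi> (Re (formula_val P env e)) (formula_val P env e')"

datatype comp = S_comp phase phase | l_comp phase phase | v_comp phase phase | s_comp phase

primrec entry :: "bus_var \<Rightarrow> comp \<Rightarrow> complex" where
  "entry x (S_comp \<phi> \<psi>) = Smat x $ \<phi> $ \<psi>"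
| "entry x (l_comp \<phi> \<psi>) = lmat x $ \<phi> $ \<psi>"
| "entry x (v_comp \<phi> \<psi>) = vmat x $ \<phi> $ \<psi>"
| "entry x (s_comp \<phi>) = svec x $ \<phi>"

definition make_x0 :: "(comp \<Rightarrow> complex) \<Rightarrow> bus_var" where
  "make_x0 g =
     \<lparr>Smat = (\<chi> \<phi> \<psi>. g (S_comp \<phi> \<psi>)), lmat = (\<chi> \<phi> \<psi>. g (l_comp \<phi> \<psi>)),
      vmat = (\<chi> \<phi> \<psi>. g (v_comp \<phi> \<psi>)), svec = (\<chi> \<phi>. g (s_comp \<phi>))\<rparr>"

definition make_x1 :: "(phase \<times> phase \<Rightarrow> complex) \<Rightarrow> cmat" where
  "make_x1 g = (\<chi> \<phi> \<psi>. g (\<phi>, \<psi>))"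

datatype input = In_rho | In_vmin phase | In_vmax phase | In_y nat comp | In_mu nat comp
  | In_lam phase phase

primrec input_val :: "net \<Rightarrow> real \<Rightarrow> nat \<Rightarrow> adm_data \<Rightarrow> input \<Rightarrow> complex" where
  "input_val N \<rho> i c In_rho = complex_of_real \<rho>"
| "input_val N \<rho> i c (In_vmin \<phi>) = complex_of_real (vmin N i \<phi>)"
| "input_val N \<rho> i c (In_vmax \<phi>) = complex_of_real (vmax N i \<phi>)"
| "input_val N \<rho> i c (In_y j k) = entry (cy c j) k"
| "input_val N \<rho> i c (In_mu j k) = entry (cmu c j) k"
| "input_val N \<rho> i c (In_lam \<phi> \<psi>) = clam c $ \<phi> $ \<psi>"

text \<open>Eigenvalues and entries (component, then column number) of the eigenvectors of a
  \<open>6 \<times> 6\<close> matrix.\<close>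

datatype eig = Eig_val "phase + phase" | Eig_vec "phase + phase" "phase + phase"

primrec eig_entry :: "(phase + phase \<Rightarrow> real) \<Rightarrow> cmat6 \<Rightarrow> eig \<Rightarrow> complex" where
  "eig_entry d U (Eig_val k) = complex_of_real (d k)"
| "eig_entry d U (Eig_vec p k) = U $ p $ k"

text \<open>
  \<open>C\<close> is the set of admissible constants, \<open>env\<close> turns constants into input values, \<open>mk\<close> assembles a
  point from its entries, and the problem for constants \<open>c\<close> is to minimise \<open>obj c\<close> over \<open>K\<close>.
  The formulas are chosen before the constants.
\<close>

definition closed_form_solvable ::
    "(phase \<Rightarrow> real \<Rightarrow> complex \<Rightarrow> complex) \<Rightarrow> 'c set \<Rightarrow> ('c \<Rightarrow> 'a \<Rightarrow> complex) \<Rightarrow>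
     (('o \<Rightarrow> complex) \<Rightarrow> 'x) \<Rightarrow> ('c \<Rightarrow> 'x \<Rightarrow> real) \<Rightarrow> 'x set \<Rightarrow> bool" where
  "closed_form_solvable P C env mk obj K \<longleftrightarrow>
     (\<exists>out :: 'o \<Rightarrow> 'a formula. \<forall>c \<in> C.
        is_arg_min (obj c) (\<lambda>x. x \<in> K) (mk (\<lambda>k. formula_val P (env c) (out k))))"

text \<open>
  Formulas \<open>M\<close> yield a \<open>6 \<times> 6\<close> Hermitian matrix, and formulas \<open>out\<close> yield a minimiser from the
  constants and any eigen-decomposition of that matrix. The existence of an eigen-decomposition is
  part of the claim, so that it cannot hold vacuously.
\<close>

definition eigen_solvable ::
    "(phase \<Rightarrow> real \<Rightarrow> complex \<Rightarrow> complex) \<Rightarrow> 'c set \<Rightarrow> ('c \<Rightarrow> 'a \<Rightarrow> complex) \<Rightarrow>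
     (('o \<Rightarrow> complex) \<Rightarrow> 'x) \<Rightarrow> ('c \<Rightarrow> 'x \<Rightarrow> real) \<Rightarrow> 'x set \<Rightarrow> bool" where
  "eigen_solvable P C env mk obj K \<longleftrightarrow>
     (\<exists>(M :: phase + phase \<Rightarrow> phase + phase \<Rightarrow> 'a formula) (out :: 'o \<Rightarrow> ('a + eig) formula).
        \<forall>c \<in> C. \<exists>X :: cmat6.
          X = (\<chi> p q. formula_val P (env c) (M p q)) \<and>
          hermitian X \<and>
          (\<exists>d U. eigen_decomposition X d U) \<and>
          (\<forall>d U. eigen_decomposition X d U \<longrightarrow>
             is_arg_min (obj c) (\<lambda>x. x \<in> K)
               (mk (\<lambda>k. formula_val P (case_sum (env c) (eig_entry d U)) (out k)))))"

definition solvable ::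
    "(phase \<Rightarrow> real \<Rightarrow> complex \<Rightarrow> complex) \<Rightarrow> 'c set \<Rightarrow> ('c \<Rightarrow> 'a \<Rightarrow> complex) \<Rightarrow>
     (('o \<Rightarrow> complex) \<Rightarrow> 'x) \<Rightarrow> ('c \<Rightarrow> 'x \<Rightarrow> real) \<Rightarrow> 'x set \<Rightarrow> bool" where
  "solvable P C env mk obj K \<longleftrightarrow>
     closed_form_solvable P C env mk obj K \<or> eigen_solvable P C env mk obj K"

text \<open>\<open>P\<close> solves every scalar problem, for all penalties \<open>r > 0\<close> and centres \<open>t\<close>.\<close>

definition scalar_solver ::
    "net \<Rightarrow> (nat \<Rightarrow> phase \<Rightarrow> real \<Rightarrow> complex \<Rightarrow> complex) \<Rightarrow> bool" where
  "scalar_solver N P \<longleftrightarrow>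
     (\<forall>i \<in> buses N. \<forall>\<phi> \<in> phases N i. \<forall>r > 0. \<forall>t.
        is_arg_min (\<lambda>s. cost N i \<phi> s + r / 2 * (cmod (s - t))\<^sup>2)
          (\<lambda>s. s \<in> region N i \<phi>) (P i \<phi> r t))"

end

theory Submission
  imports Defs
begin

text \<open>
  In each of the two subproblems all penalty terms can be merged into one by completing the square.

  For \<open>x\<^sub>i\<^sub>0\<close> this works because of the choice of the weights: the coefficients of
  \<open>\<parallel>S\<parallel>\<^sup>2\<close>, \<open>\<parallel>\<ell>\<parallel>\<^sup>2\<close> and \<open>\<parallel>v\<parallel>\<^sup>2\<close>, summed over the neighbours of bus \<open>i\<close>, are \<open>2 k\<close>, \<open>k\<close> and \<open>k\<close> with
  \<open>k = card (children N i) + 2\<close>. As \<open>S\<close> occurs twice in the block matrix, the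
  merged penalty in \<open>S\<close>, \<open>\<ell>\<close>, \<open>v\<close> is \<open>k\<close> times the squared Frobenius distance of the block matrix from a
  known Hermitian matrix \<open>Z\<close> (\<open>H0_complete_square\<close>). At the root the coefficients differ, but
  there \<open>S\<close> and \<open>\<ell>\<close> vanish. The objective and the constraints now decouple:

  \<^item> in the block matrix the task is to project \<open>Z\<close> onto the cone of positive semidefinite
    matrices, and the projection is obtained from an eigen-decomposition of \<open>Z\<close> by replacing
    the negative eigenvalues by zero (\<open>positive_part_nearest_psd\<close>);
  \<^item> in \<open>s\<close> the problem splits over the phases into the scalar problems which the given solver
    solves, with penalty \<open>\<rho>\<close> (\<open>scalar_part_minimal\<close>).

  Rows of \<open>Z\<close> that vanish because of zero padding stay zero in the projection
  (\<open>positive_part_zero_row\<close>), so the projection yields a variable of the right shape. That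
  an eigen-decomposition exists is the spectral theorem, which is proved first.

  For \<open>x\<^sub>i\<^sub>1\<close> the merged penalty is the squared distance of \<open>v\<close> from a Hermitian matrix, and the
  constraints are intervals for the diagonal entries. The distance is a sum over entries, so it is minimal
  when the diagonal entries of that matrix are clamped to their intervals and the other entries are kept.
\<close>

section \<open>Spectral theorem for Hermitian matrices\<close>

text \<open>The real part of the complex inner product is the library's real inner product, which is what
  psd and the norms are formulated with; orthonormality of eigenvectors needs the complex one.\<close>

definition hip :: "complex^'n \<Rightarrow> complex^'n \<Rightarrow> complex" where
  "hip u w = (\<Sum>p\<in>UNIV. cnj (u $ p) * w $ p)"

lemma Re_hip: "Re (hip u w) = u \<bullet> w"
  by (simp add: hip_def inner_vec_def inner_complex_def)

lemma hip_self: "hip u u = complex_of_real (u \<bullet> u)"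
  by (simp add: hip_def inner_vec_def inner_complex_def complex_eq_iff algebra_simps)

lemma cnj_hip: "cnj (hip u w) = hip w u"
  by (simp add: hip_def mult.commute)

lemma hip_add: "hip u (v + w) = hip u v + hip u w"
  by (simp add: hip_def algebra_simps sum.distrib)

lemma hip_smult: "hip u (a *s w) = a * hip u w"
  by (simp add: hip_def algebra_simps sum_distrib_left)

lemma hip_smult_left: "hip (a *s u) w = cnj a * hip u w"
  by (simp add: hip_def algebra_simps sum_distrib_left)

lemma hip_scaleR: "hip u (a *\<^sub>R w) = complex_of_real a * hip u w"
  by (simp add: hip_def algebra_simps sum_distrib_left scaleR_conv_of_real[where 'a = complex])

lemma continuous_on_hip: "continuous_on A (hip u)"
  unfolding hip_def by (intro continuous_intros)

lemma hip_hermitian: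
  assumes "hermitian X"
  shows "hip u (X *v w) = hip (X *v u) w"
proof -
  have X: "cnj (X $ q $ p) = X $ p $ q" for p q
    using assms unfolding hermitian_def adj_def by (simp add: vec_eq_iff)
  have "hip u (X *v w) = (\<Sum>p\<in>UNIV. \<Sum>q\<in>UNIV. cnj (u $ p) * (X $ p $ q * w $ q))"
    by (simp add: hip_def matrix_vector_mult_def sum_distrib_left)
  also have "\<dots> = (\<Sum>q\<in>UNIV. \<Sum>p\<in>UNIV. cnj (u $ p) * (X $ p $ q * w $ q))"
    by (rule sum.swap)
  also have "\<dots> = hip (X *v u) w"
    by (simp add: hip_def matrix_vector_mult_def sum_distrib_left X mult_ac)
  finally show ?thesis .
qed

lemma inner_hermitian:
  assumes "hermitian X"
  shows "u \<bullet> (X *v w) = (X *v u) \<bullet> w"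
  using hip_hermitian[OF assms] by (metis Re_hip)

lemma scaleR_eq_smult: "a *\<^sub>R (w :: complex^'n) = complex_of_real a *s w"
  by (simp add: vec_eq_iff scaleR_conv_of_real[where 'a = complex])

lemma matrix_vector_mult_scaleR_complex:
  "(X :: complex^'n^'m) *v (a *\<^sub>R w) = a *\<^sub>R (X *v w)"
  by (simp add: scaleR_eq_smult vector_scalar_commute)

text \<open>The matrix with rows \<open>(u l)\<^sup>H\<close> for \<open>l \<in> K\<close> and zero rows otherwise is singular, since it has a
  zero row; a nonzero vector of its kernel is orthogonal to all \<open>u l\<close>.\<close>

lemma nonzero_orthogonal_vector:
  fixes u :: "'n \<Rightarrow> complex^'n"
  assumes "k \<notin> K"
  shows "\<exists>w. w \<noteq> 0 \<and> (\<forall>l\<in>K. hip (u l) w = 0)"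
proof -
  define A :: "complex^'n^'n" where "A = (\<chi> l p. if l \<in> K then cnj (u l $ p) else 0)"
  have Aw: "(A *v w) $ l = (if l \<in> K then hip (u l) w else 0)" for w l
    by (simp add: A_def matrix_vector_mult_def hip_def)
  have "(A ** B) $ k $ k = 0" for B :: "complex^'n^'n"
    using assms by (simp add: A_def matrix_matrix_mult_def)
  moreover have "(mat 1 :: complex^'n^'n) $ k $ k \<noteq> 0"
    by (simp add: mat_def)
  ultimately have "A ** B \<noteq> mat 1" for B :: "complex^'n^'n"
    by metis
  then have "\<nexists>B. B ** A = mat 1"
    by (metis matrix_left_right_inverse)
  then obtain w where w: "A *v w = 0" "w \<noteq> 0"
    unfolding matrix_left_invertible_ker by blast
  have "hip (u l) w = 0" if "l \<in> K" for l
    using Aw[of w l] w(1) that by simp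
  with w(2) show ?thesis by blast
qed

text \<open>A maximiser \<open>z\<close> of the Rayleigh quotient on an invariant subspace is an eigenvector: moving from \<open>z\<close>
  in the direction of the residual \<open>r = m z - X z\<close> keeps the form \<open>m (w \<bullet> w) - w \<bullet> (X w)\<close> nonnegative,
  but changes it to first order by \<open>2 t (r \<bullet> r)\<close>, so \<open>r = 0\<close>. The eigenvalue is
  real, being a value of the quotient.\<close>

lemma max_quadratic_form_is_eigenvector:
  fixes X :: "complex^'n^'n"
  assumes X: "hermitian X" and V: "subspace V" "z \<in> V"
    and inv: "\<And>w. w \<in> V \<Longrightarrow> X *v w \<in> V"
    and bound: "\<And>w. w \<in> V \<Longrightarrow> w \<bullet> (X *v w) \<le> m * (w \<bullet> w)"
    and attained: "z \<bullet> (X *v z) = m * (z \<bullet> z)"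
  shows "X *v z = complex_of_real m *s z"
proof -
  define r where "r = m *\<^sub>R z - X *v z"
  have rV: "r \<in> V"
    unfolding r_def using V inv by (intro subspace_diff subspace_scale) auto
  define g where "g = m * (r \<bullet> r) - r \<bullet> (X *v r)"
  have g0: "g \<ge> 0"
    unfolding g_def using bound[OF rV] by simp
  have sym: "z \<bullet> (X *v r) = r \<bullet> (X *v z)"
    using inner_hermitian[OF X, of z r] by (simp add: inner_commute)
  have b: "r \<bullet> (X *v z) = m * (r \<bullet> z) - r \<bullet> r"
    by (subst (4) r_def) (simp add: inner_diff_right)
  have nonneg: "0 \<le> 2 * t * (r \<bullet> r) + t\<^sup>2 * g" for t
  proof -
    have "z + t *\<^sub>R r \<in> V"
      using V rV by (intro subspace_add subspace_scale) auto
    from bound[OF this] attained sym b show ?thesis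
      unfolding g_def
      by (simp add: matrix_vector_right_distrib matrix_vector_mult_scaleR_complex inner_add_left
          inner_add_right inner_commute[of z r] power2_eq_square algebra_simps)
  qed
  have "r \<bullet> r = 0"
  proof (rule ccontr)
    assume "r \<bullet> r \<noteq> 0"
    then have pos: "r \<bullet> r > 0" by (simp add: inner_gt_zero_iff)
    \<comment> \<open>The step \<open>t = - s (r \<bullet> r)\<close> is short enough for the linear term to outweigh the quadratic one.\<close>
    define s where "s = 1 / (g + 1)"
    have s: "s > 0" "s * g \<le> 1" using g0 unfolding s_def by auto
    have "2 * (- (r \<bullet> r) * s) * (r \<bullet> r) + (- (r \<bullet> r) * s)\<^sup>2 * g = (r \<bullet> r)\<^sup>2 * s * (s * g - 2)"
      by (simp add: power2_eq_square algebra_simps)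
    also have "\<dots> < 0"
      using s pos by (intro mult_pos_neg) auto
    finally show False using nonneg[of "- (r \<bullet> r) * s"] by simp
  qed
  then show ?thesis
    unfolding r_def by (simp add: scaleR_eq_smult)
qed

text \<open>The orthogonal complement of eigenvectors is invariant under a Hermitian matrix, so a
  maximiser of the quadratic form on the unit sphere of the complement, which exists by compactness, is
  an eigenvector orthogonal to the given ones.\<close>

lemma hermitian_eigenvector_in_complement:
  fixes X :: "complex^'n^'n" and u :: "'n \<Rightarrow> complex^'n"
  assumes X: "hermitian X" and "k \<notin> K"
    and eig: "\<And>l. l \<in> K \<Longrightarrow> X *v u l = complex_of_real (d l) *s u l"
  shows "\<exists>z m. hip z z = 1 \<and> (\<forall>l\<in>K. hip (u l) z = 0) \<and> X *v z = complex_of_real m *s z"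
proof -
  define V where "V = {w. \<forall>l\<in>K. hip (u l) w = 0}"
  have sub: "subspace V"
    unfolding subspace_def V_def by (auto simp: hip_add hip_scaleR) (simp add: hip_def)
  have inv: "X *v w \<in> V" if "w \<in> V" for w
    using that unfolding V_def by (simp add: hip_hermitian[OF X] eig hip_smult_left)
  obtain w0 where w0: "w0 \<noteq> 0" "\<forall>l\<in>K. hip (u l) w0 = 0"
    using nonzero_orthogonal_vector[OF assms(2), of u] by blast
  then have w0V: "w0 \<in> V" by (simp add: V_def)
  let ?S = "sphere 0 1 \<inter> V"
  have "closed V"
    unfolding V_def Collect_ball_eq
    by (intro closed_INT ballI closed_Collect_eq continuous_on_hip continuous_intros)
  then have comp: "compact ?S" by (simp add: compact_Int_closed)
  have ne: "?S \<noteq> {}"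
  proof -
    have "(1 / norm w0) *\<^sub>R w0 \<in> ?S"
      using w0(1) w0V sub by (simp add: subspace_scale)
    then show ?thesis by blast
  qed
  have cont: "continuous_on ?S (\<lambda>w. w \<bullet> (X *v w))"
    by (intro continuous_intros)
  obtain z where z: "z \<in> ?S" and zmax: "\<And>w. w \<in> ?S \<Longrightarrow> w \<bullet> (X *v w) \<le> z \<bullet> (X *v z)"
    using continuous_attains_sup[OF comp ne cont] by blast
  have zz: "z \<bullet> z = 1" using z by (simp add: dot_square_norm)
  define m where "m = z \<bullet> (X *v z)"
  have bound: "w \<bullet> (X *v w) \<le> m * (w \<bullet> w)" if "w \<in> V" for w
  proof (cases "w = 0")
    case False
    define y where "y = (1 / norm w) *\<^sub>R w"
    have "y \<in> ?S" using False that sub by (simp add: y_def subspace_scale)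
    then have "y \<bullet> (X *v y) \<le> m" unfolding m_def by (rule zmax)
    moreover have "w \<bullet> (X *v w) = (norm w)\<^sup>2 * (y \<bullet> (X *v y))"
    proof -
      have "w = norm w *\<^sub>R y" using False by (simp add: y_def)
      then have "w \<bullet> (X *v w) = (norm w *\<^sub>R y) \<bullet> (X *v (norm w *\<^sub>R y))" by (rule arg_cong)
      then show ?thesis
        by (simp only: matrix_vector_mult_scaleR_complex inner_scaleR_left inner_scaleR_right
            power2_eq_square mult.assoc)
    qed
    ultimately show ?thesis
      by (simp add: dot_square_norm mult.commute[of m] mult_left_mono)
  qed simp
  have "X *v z = complex_of_real m *s z"
    using z zz by (intro max_quadratic_form_is_eigenvector[OF X sub _ inv bound]) (auto simp: m_def)
  moreover have "hip z z = 1" using zz by (simp add: hip_self)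
  moreover have "hip (u l) z = 0" if "l \<in> K" for l
    using z that by (simp add: V_def)
  ultimately show ?thesis by blast
qed

text \<open>Induction over sets of column indices, instead of dimensions: each step adds one eigenvector.\<close>

lemma hermitian_partial_eigenbasis:
  fixes X :: "complex^'n^'n"
  assumes X: "hermitian X" and "finite K"
  shows "\<exists>(u :: 'n \<Rightarrow> complex^'n) d. (\<forall>k\<in>K. X *v u k = complex_of_real (d k) *s u k) \<and>
               (\<forall>k\<in>K. \<forall>l\<in>K. hip (u k) (u l) = (if k = l then 1 else 0))"
  using assms(2)
proof (induction K rule: finite_induct)
  case empty
  then show ?case by simp
next
  case (insert k K)
  then obtain u d where eig: "\<And>l. l \<in> K \<Longrightarrow> X *v u l = complex_of_real (d l) *s u l"
    and orth: "\<And>j l. j \<in> K \<Longrightarrow> l \<in> K \<Longrightarrow> hip (u j) (u l) = (if j = l then 1 else 0)"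
    by blast
  obtain z m where z: "hip z z = 1" "\<forall>l\<in>K. hip (u l) z = 0"
    "X *v z = complex_of_real m *s z"
    using hermitian_eigenvector_in_complement[OF X insert.hyps(2), of u d] eig by blast
  have z': "hip z (u l) = 0" if "l \<in> K" for l
    using z(2) that cnj_hip[of "u l" z] by simp
  show ?case
    using insert.hyps(2) eig orth z z'
    by (intro exI[of _ "u(k := z)"] exI[of _ "d(k := m)"]) auto
qed

theorem hermitian_eigen_decomposition:
  fixes X :: "complex^'n^'n"
  assumes "hermitian X"
  shows "\<exists>d U. eigen_decomposition X d U"
proof -
  obtain u :: "'n \<Rightarrow> complex^'n" and d where eig: "\<And>k. X *v u k = complex_of_real (d k) *s u k"
    and orth: "\<And>k l. hip (u k) (u l) = (if k = l then 1 else 0)"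
    using hermitian_partial_eigenbasis[OF assms finite_class.finite_UNIV] by auto
  define U :: "complex^'n^'n" where "U = (\<chi> p k. u k $ p)"
  have "column k U = u k" for k
    by (simp add: U_def column_def vec_eq_iff)
  moreover have "adj U ** U = mat 1"
    using orth by (simp add: vec_eq_iff adj_def U_def matrix_matrix_mult_def mat_def hip_def)
  ultimately show ?thesis
    unfolding eigen_decomposition_def using eig by metis
qed

section \<open>Projection onto the positive semidefinite cone\<close>

text \<open>The matrix \<open>U D U\<^sup>H\<close> with \<open>D\<close> the diagonal matrix of the \<open>g k\<close>.\<close>

definition spectral_sum :: "complex^'n^'n \<Rightarrow> ('n \<Rightarrow> real) \<Rightarrow> complex^'n^'n" where
  "spectral_sum U g = (\<chi> p q. \<Sum>k\<in>UNIV. complex_of_real (g k) * U $ p $ k * cnj (U $ q $ k))"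

lemma hermitian_spectral_sum: "hermitian (spectral_sum U g)"
  by (simp add: hermitian_def adj_def spectral_sum_def mult_ac)

lemma spectral_sum_mult_vec:
  "spectral_sum U g *v z = (\<Sum>k\<in>UNIV. (complex_of_real (g k) * hip (column k U) z) *s column k U)"
proof -
  have "(spectral_sum U g *v z) $ p =
      (\<Sum>q\<in>UNIV. \<Sum>k\<in>UNIV. complex_of_real (g k) * U $ p $ k * cnj (U $ q $ k) * z $ q)" for p
    by (simp add: spectral_sum_def matrix_vector_mult_def sum_distrib_right)
  also have "\<dots> p = (\<Sum>k\<in>UNIV. \<Sum>q\<in>UNIV. complex_of_real (g k) * U $ p $ k * cnj (U $ q $ k) * z $ q)" for p
    by (rule sum.swap)
  finally show ?thesis
    by (simp add: vec_eq_iff hip_def column_def sum_distrib_left sum_distrib_right mult_ac)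
qed

lemma inner_spectral_sum:
  "Y \<bullet> spectral_sum U g = (\<Sum>k\<in>UNIV. g k * (column k U \<bullet> (Y *v column k U)))"
proof -
  have inner: "a \<bullet> b = Re (a * cnj b)" for a b :: complex
    by (simp add: inner_complex_def)
  have "Y \<bullet> spectral_sum U g =
      (\<Sum>p\<in>UNIV. \<Sum>q\<in>UNIV. \<Sum>k\<in>UNIV. g k * Re (cnj (U $ p $ k) * Y $ p $ q * U $ q $ k))"
    unfolding inner_vec_def inner spectral_sum_def
    by (simp add: sum_distrib_left algebra_simps del: complex_cnj_mult)
  also have "\<dots> = (\<Sum>p\<in>UNIV. \<Sum>k\<in>UNIV. \<Sum>q\<in>UNIV. g k * Re (cnj (U $ p $ k) * Y $ p $ q * U $ q $ k))"
    by (intro sum.cong refl sum.swap)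
  also have "\<dots> = (\<Sum>k\<in>UNIV. \<Sum>p\<in>UNIV. \<Sum>q\<in>UNIV. g k * Re (cnj (U $ p $ k) * Y $ p $ q * U $ q $ k))"
    by (rule sum.swap)
  also have "\<dots> = (\<Sum>k\<in>UNIV. g k * (column k U \<bullet> (Y *v column k U)))"
    by (simp add: Re_hip[symmetric] hip_def matrix_vector_mult_def column_def sum_distrib_left mult.assoc)
  finally show ?thesis .
qed

lemma hip_columns:
  assumes "adj U ** U = mat 1"
  shows "hip (column k U) (column l U) = (if k = l then 1 else 0)"
proof -
  have "(adj U ** U) $ k $ l = mat 1 $ k $ l" by (simp only: assms)
  then show ?thesis
    by (simp add: hip_def column_def adj_def matrix_matrix_mult_def mat_def)
qed

lemma spectral_sum_eigenvector:
  assumes "adj U ** U = mat 1"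
  shows "spectral_sum U g *v column k U = complex_of_real (g k) *s column k U"
proof -
  have "spectral_sum U g *v column k U =
      (\<Sum>l\<in>UNIV. if l = k then complex_of_real (g k) *s column k U else 0)"
    unfolding spectral_sum_mult_vec hip_columns[OF assms] by (intro sum.cong) auto
  then show ?thesis by simp
qed

lemma psd_spectral_sum:
  assumes "\<And>k. 0 \<le> g k"
  shows "psd (spectral_sum U g)"
  unfolding psd_def
proof (intro conjI allI hermitian_spectral_sum)
  fix z
  have "z \<bullet> (spectral_sum U g *v z) = (\<Sum>k\<in>UNIV. g k * (cmod (hip (column k U) z))\<^sup>2)"
  proof -
    have "Re (hip z ((complex_of_real (g k) * hip (column k U) z) *s column k U))
        = g k * (cmod (hip (column k U) z))\<^sup>2" for k
      using cnj_hip[of "column k U" z, symmetric]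
      by (simp add: hip_smult cmod_def power2_eq_square distrib_left)
    then show ?thesis
      by (simp add: spectral_sum_mult_vec inner_sum_right Re_hip)
  qed
  also have "\<dots> \<ge> 0" using assms by (intro sum_nonneg) auto
  finally show "0 \<le> z \<bullet> (spectral_sum U g *v z)" .
qed

lemma eigen_decomposition_spectral_sum:
  assumes "eigen_decomposition X d U"
  shows "X = spectral_sum U d"
proof -
  have UU: "U ** adj U = mat 1"
    using assms matrix_left_right_inverse unfolding eigen_decomposition_def by blast
  have col: "(X ** U) $ p $ k = complex_of_real (d k) * U $ p $ k" for p k
  proof -
    have "(X *v column k U) $ p = (complex_of_real (d k) *s column k U) $ p"
      using assms unfolding eigen_decomposition_def by simp
    then show ?thesis
      by (simp add: matrix_vector_mult_def matrix_matrix_mult_def column_def)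
  qed
  have "X = (X ** U) ** adj U"
    by (simp add: UU matrix_mul_assoc[symmetric])
  also have "\<dots> = spectral_sum U d"
    by (simp add: vec_eq_iff matrix_matrix_mult_def[of "X ** U"] col adj_def spectral_sum_def)
  finally show ?thesis .
qed

lemma spectral_sum_diff: "spectral_sum U g - spectral_sum U h = spectral_sum U (\<lambda>k. g k - h k)"
  by (simp add: spectral_sum_def vec_eq_iff sum_subtractf algebra_simps)

text \<open>With \<open>X\<^sub>+ = spectral_sum U (max d 0)\<close>, the matrix \<open>X\<^sub>+ - X\<close> is positive semidefinite, so its inner
  product with every positive semidefinite \<open>Y\<close> is nonnegative, while it is orthogonal to \<open>X\<^sub>+\<close>. Hence the cross
  term \<open>(Y - X\<^sub>+) \<bullet> (X\<^sub>+ - X)\<close> in the expansion of \<open>\<parallel>Y - X\<parallel>\<^sup>2\<close> is nonnegative.\<close>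

theorem positive_part_nearest_psd:
  assumes X: "eigen_decomposition X d U" and Y: "psd Y"
  shows "norm (spectral_sum U (\<lambda>k. max (d k) 0) - X) \<le> norm (Y - X)"
proof -
  let ?X = "spectral_sum U (\<lambda>k. max (d k) 0)"
  have orth: "adj U ** U = mat 1" using X unfolding eigen_decomposition_def by blast
  have neg: "?X - X = spectral_sum U (\<lambda>k. max (- d k) 0)"
  proof -
    have "max (d k) 0 - d k = max (- d k) 0" for k by linarith
    then show ?thesis
      by (subst eigen_decomposition_spectral_sum[OF X]) (simp add: spectral_sum_diff)
  qed
  have "Y \<bullet> (?X - X) \<ge> 0"
    using Y unfolding neg inner_spectral_sum psd_def by (intro sum_nonneg mult_nonneg_nonneg) auto
  moreover have "?X \<bullet> (?X - X) = 0"
    unfolding neg inner_spectral_sum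
    by (intro sum.neutral) (auto simp: spectral_sum_eigenvector[OF orth] scaleR_eq_smult[symmetric] max_def)
  ultimately have "(Y - ?X) \<bullet> (?X - X) \<ge> 0" by (simp add: inner_diff_left)
  moreover have "(norm (Y - X))\<^sup>2 = (norm (Y - ?X))\<^sup>2 + 2 * ((Y - ?X) \<bullet> (?X - X)) + (norm (?X - X))\<^sup>2"
    by (simp add: power2_norm_eq_inner inner_diff_left inner_diff_right inner_commute)
  ultimately have "(norm (?X - X))\<^sup>2 \<le> (norm (Y - X))\<^sup>2" by simp
  then show ?thesis by simp
qed

text \<open>An eigenvector for a nonzero eigenvalue is in the range of \<open>X\<close> and so vanishes at the index of a
  zero row.\<close>

lemma positive_part_zero_row:
  assumes X: "eigen_decomposition X d U" and row: "\<And>q. X $ p $ q = 0"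
  shows "spectral_sum U (\<lambda>k. max (d k) 0) $ p $ q = 0"
    and "spectral_sum U (\<lambda>k. max (d k) 0) $ q $ p = 0"
proof -
  have "complex_of_real (d k) * U $ p $ k = 0" for k
  proof -
    have "(X *v column k U) $ p = (complex_of_real (d k) *s column k U) $ p"
      using X unfolding eigen_decomposition_def by simp
    then show ?thesis by (simp add: matrix_vector_mult_def row column_def)
  qed
  then have "d k = 0 \<or> U $ p $ k = 0" for k by (metis mult_eq_0_iff of_real_eq_0_iff)
  then have z: "complex_of_real (max (d k) 0) * U $ p $ k = 0" for k
    by (metis max.idem mult_eq_0_iff of_real_0)
  then have z': "complex_of_real (max (d k) 0) * cnj (U $ p $ k) = 0" for k
    by (metis complex_cnj_zero_iff mult_eq_0_iff)
  show "spectral_sum U (\<lambda>k. max (d k) 0) $ p $ q = 0"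
    unfolding spectral_sum_def vec_lambda_beta z by simp
  show "spectral_sum U (\<lambda>k. max (d k) 0) $ q $ p = 0"
    unfolding spectral_sum_def vec_lambda_beta mult.assoc mult.left_commute[of _ "U $ q $ _"] z'
    by simp
qed

section \<open>Completing the square\<close>

text \<open>The minimiser of a sum of linear terms \<open>m j\<close> and penalties of weight \<open>w j\<close> around \<open>y j\<close>.\<close>

definition weighted_centre :: "'j set \<Rightarrow> ('j \<Rightarrow> nat) \<Rightarrow> real \<Rightarrow> ('j \<Rightarrow> 'v) \<Rightarrow> ('j \<Rightarrow> 'v) \<Rightarrow> 'v::real_vector"
  where "weighted_centre J w r m y =
     (1 / real (sum w J)) *\<^sub>R (\<Sum>j\<in>J. real (w j) *\<^sub>R y j - (1 / r) *\<^sub>R m j)"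

lemma complete_square:
  fixes x :: "'v::real_inner"
  assumes "r > 0" and "sum w J > 0"
  shows "(\<Sum>j\<in>J. m j \<bullet> x + r / 2 * (real (w j) * (norm (x - y j))\<^sup>2)) =
      r / 2 * (real (sum w J) * (norm (x - weighted_centre J w r m y))\<^sup>2) +
      ((\<Sum>j\<in>J. r / 2 * (real (w j) * (norm (y j))\<^sup>2))
       - r / 2 * (real (sum w J) * (norm (weighted_centre J w r m y))\<^sup>2))"
proof -
  let ?c = "weighted_centre J w r m y" and ?W = "real (sum w J)"
  have Wc: "?W *\<^sub>R ?c = (\<Sum>j\<in>J. real (w j) *\<^sub>R y j - (1 / r) *\<^sub>R m j)"
    using assms(2) by (simp add: weighted_centre_def del: of_nat_sum)
  have "r * (?W * (?c \<bullet> x)) = r * ((?W *\<^sub>R ?c) \<bullet> x)" by simp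
  also have "\<dots> = (\<Sum>j\<in>J. r * (real (w j) * (y j \<bullet> x)) - m j \<bullet> x)"
    unfolding Wc using assms(1)
    by (simp add: inner_sum_left inner_diff_left sum_distrib_left right_diff_distrib)
  finally have cross: "r * (?W * (?c \<bullet> x)) = (\<Sum>j\<in>J. r * (real (w j) * (y j \<bullet> x)) - m j \<bullet> x)" .
  have summand: "m j \<bullet> x + r / 2 * (real (w j) * (norm (x - y j))\<^sup>2) =
      r / 2 * (real (w j) * (x \<bullet> x)) - (r * (real (w j) * (y j \<bullet> x)) - m j \<bullet> x)
      + r / 2 * (real (w j) * (norm (y j))\<^sup>2)" for j
    by (simp add: power2_norm_eq_inner inner_diff_left inner_diff_right inner_commute[of x "y j"] algebra_simps)
  have "(\<Sum>j\<in>J. r / 2 * (real (w j) * (x \<bullet> x))) = r / 2 * (?W * (x \<bullet> x))"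
    by (simp add: sum_distrib_left sum_distrib_right)
  then have "(\<Sum>j\<in>J. m j \<bullet> x + r / 2 * (real (w j) * (norm (x - y j))\<^sup>2)) =
      r / 2 * (?W * (x \<bullet> x)) - r * (?W * (?c \<bullet> x)) + (\<Sum>j\<in>J. r / 2 * (real (w j) * (norm (y j))\<^sup>2))"
    unfolding summand sum.distrib sum_subtractf cross by simp
  then show ?thesis
    by (simp add: power2_norm_eq_inner inner_diff_left inner_diff_right inner_commute[of x ?c] algebra_simps)
qed

lemma weighted_centre_nth:
  "weighted_centre J w r m y $ p = weighted_centre J w r (\<lambda>j. m j $ p) (\<lambda>j. y j $ p)"
  by (simp add: weighted_centre_def)

lemma weighted_centre_in_subspace:
  assumes "subspace V" and "\<And>j. j \<in> J \<Longrightarrow> m j \<in> V" and "\<And>j. j \<in> J \<Longrightarrow> y j \<in> V"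
  shows "weighted_centre J w r m y \<in> V"
  unfolding weighted_centre_def using assms
  by (intro subspace_scale subspace_sum subspace_diff)

section \<open>Formulas and block matrices\<close>

lemma subspace_mats_on: "subspace (mats_on Q)"
  by (auto simp: subspace_def mats_on_def)

lemma subspace_herms_on: "subspace (herms_on Q)"
  unfolding subspace_def herms_on_def mats_on_def hermitian_def adj_def
  by (auto simp: vec_eq_iff scaleR_conv_of_real[where 'a = complex])

lemma subspace_vecs_on: "subspace (vecs_on Q)"
  by (auto simp: subspace_def vecs_on_def)

text \<open>The order of the summands is an arbitrary enumeration of \<open>J\<close>, fixed by choice.\<close>

definition formula_sum :: "'b set \<Rightarrow> ('b \<Rightarrow> 'a formula) \<Rightarrow> 'a formula" where
  "formula_sum J e = foldr (\<lambda>j. Plus (e j)) (SOME js. set js = J \<and> distinct js) (Lit 0)"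

lemma formula_val_sum:
  assumes "finite J"
  shows "formula_val P env (formula_sum J e) = (\<Sum>j\<in>J. formula_val P env (e j))"
proof -
  define js where "js = (SOME js. set js = J \<and> distinct js)"
  have js: "set js = J \<and> distinct js"
    unfolding js_def by (rule someI_ex) (rule finite_distinct_list[OF assms])
  have "formula_val P env (foldr (\<lambda>j. Plus (e j)) js (Lit 0)) = sum_list (map (\<lambda>j. formula_val P env (e j)) js)"
    by (induction js) simp_all
  also have "\<dots> = (\<Sum>j\<in>J. formula_val P env (e j))"
    using js by (metis sum_list_distinct_conv_sum_set)
  finally show ?thesis by (simp add: formula_sum_def js_def)
qed

lemma formula_val_map_Inl:
  "formula_val P (case_sum f g) (map_formula Inl e) = formula_val P f e"
  by (induction e) simp_all

text \<open>The factor 2 is the reason why the weights of \<open>S\<close> are about twice those of \<open>\<ell>\<close> and \<open>v\<close>.\<close>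

lemma square_norm_block:
  "(norm (block v S l))\<^sup>2 = (norm v)\<^sup>2 + 2 * (norm S)\<^sup>2 + (norm l)\<^sup>2"
proof -
  have sum_plus: "(\<Sum>p\<in>UNIV. f p) = (\<Sum>p\<in>UNIV. f (Inl p)) + (\<Sum>p\<in>UNIV. f (Inr p))"
    for f :: "phase + phase \<Rightarrow> real"
    by (simp add: UNIV_Plus_UNIV[symmetric] sum.Plus del: UNIV_Plus_UNIV)
  have mat: "(norm A)\<^sup>2 = (\<Sum>p\<in>UNIV. \<Sum>q\<in>UNIV. (cmod (A $ p $ q))\<^sup>2)"
    for A :: "complex^'n^'m"
    by (simp add: norm_vec_def L2_set_def sum_nonneg)
  have "(\<Sum>p\<in>UNIV. \<Sum>q\<in>UNIV. (cmod (S $ q $ p))\<^sup>2) = (norm S)\<^sup>2"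
    unfolding mat by (rule sum.swap)
  then show ?thesis
    unfolding mat[of "block v S l"] mat[of v] mat[of l] sum_plus
    by (simp add: block_def adj_def sum.distrib mat[of S])
qed

lemma block_diff: "block v S l - block v' S' l' = block (v - v') (S - S') (l - l')"
  by (auto simp: block_def adj_def vec_eq_iff split: sum.split)

lemma hermitian_block:
  assumes "hermitian v" "hermitian l"
  shows "hermitian (block v S l)"
  using assms unfolding hermitian_def adj_def block_def
  by (auto simp: vec_eq_iff split: sum.split)

definition upper_left :: "cmat6 \<Rightarrow> cmat" where "upper_left X = (\<chi> p q. X $ Inl p $ Inl q)"
definition upper_right :: "cmat6 \<Rightarrow> cmat" where "upper_right X = (\<chi> p q. X $ Inl p $ Inr q)"
definition lower_right :: "cmat6 \<Rightarrow> cmat" where "lower_right X = (\<chi> p q. X $ Inr p $ Inr q)"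

lemma block_of_parts:
  assumes "hermitian X"
  shows "block (upper_left X) (upper_right X) (lower_right X) = X"
  using assms unfolding hermitian_def adj_def block_def upper_left_def upper_right_def lower_right_def
  by (auto simp: vec_eq_iff split: sum.split)

lemma hermitian_parts:
  assumes "hermitian X"
  shows "hermitian (upper_left X)" "hermitian (lower_right X)"
  using assms unfolding hermitian_def adj_def upper_left_def lower_right_def
  by (auto simp: vec_eq_iff)

section \<open>The subproblem for the first block of variables\<close>

text \<open>The coefficients in the weighted norms, with 0 for the components that \<open>y\<^sub>i\<^sub>j\<close> lacks, so that all
  neighbours can be treated alike.\<close>

primrec weight :: "net \<Rightarrow> nat \<Rightarrow> nat \<Rightarrow> comp \<Rightarrow> nat" where
  "weight N i j (S_comp \<phi> \<psi>) =
     (if j = i then 2 * card (children N i) + 3 else if i \<noteq> 0 \<and> j = parent N i then 1 else 0)"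
| "weight N i j (l_comp \<phi> \<psi>) =
     (if j = i then card (children N i) + 1 else if i \<noteq> 0 \<and> j = parent N i then 1 else 0)"
| "weight N i j (v_comp \<phi> \<psi>) = (if j = i then 2 else if i \<noteq> 0 \<and> j = parent N i then 0 else 1)"
| "weight N i j (s_comp \<phi>) = (if j = i then 1 else 0)"

text \<open>Without acyclicity a neighbour could have two roles and the weights would not add up.\<close>

lemma parent_not_self_or_child:
  assumes "rooted_tree N" "i \<in> buses N" "i \<noteq> 0"
  shows "parent N i \<noteq> i" "parent N i \<notin> children N i"
proof -
  obtain k where k: "(parent N ^^ k) i = 0"
    using assms unfolding rooted_tree_def by blast
  show 1: "parent N i \<noteq> i"
  proof
    assume "parent N i = i"
    then have "(parent N ^^ k) i = i" by (induction k) auto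
    with k assms(3) show False by simp
  qed
  show "parent N i \<notin> children N i"
  proof
    assume "parent N i \<in> children N i"
    then have p: "parent N i \<noteq> 0" "parent N (parent N i) = i"
      by (auto simp: children_def)
    have "(parent N ^^ k) i = i \<or> (parent N ^^ k) i = parent N i"
      using p(2) by (induction k) auto
    with k assms(3) p(1) show False by auto
  qed
qed

lemma not_own_child:
  assumes "rooted_tree N" "i \<in> buses N"
  shows "i \<notin> children N i"
  using parent_not_self_or_child(1)[OF assms] by (auto simp: children_def)

lemma finite_children: "finite (children N i)"
  by (simp add: children_def buses_def)

lemma finite_nbrs: "finite (nbrs N i)"
  by (simp add: nbrs_def finite_children)

lemma sum_nbrs:
  fixes f :: "nat \<Rightarrow> nat"
  assumes "rooted_tree N" "i \<in> buses N"
  shows "(\<Sum>j\<in>nbrs N i. f j) =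
    f i + (if i = 0 then 0 else f (parent N i)) + (\<Sum>j\<in>children N i. f j)"
proof (cases "i = 0")
  case True
  then show ?thesis
    using not_own_child[OF assms] by (simp add: nbrs_def finite_children)
next
  case False
  then have "nbrs N i = insert i (insert (parent N i) (children N i))"
    by (auto simp: nbrs_def)
  then show ?thesis
    using False parent_not_self_or_child[OF assms False] not_own_child[OF assms]
    by (simp add: finite_children)
qed

lemma sum_weights:
  assumes "rooted_tree N" "i \<in> buses N"
  shows "(\<Sum>j\<in>nbrs N i. weight N i j (S_comp \<phi> \<psi>)) = 2 * card (children N i) + 3 + (if i = 0 then 0 else 1)"
    and "(\<Sum>j\<in>nbrs N i. weight N i j (l_comp \<phi> \<psi>)) = card (children N i) + 1 + (if i = 0 then 0 else 1)"
    and "(\<Sum>j\<in>nbrs N i. weight N i j (v_comp \<phi> \<psi>)) = card (children N i) + 2"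
    and "(\<Sum>j\<in>nbrs N i. weight N i j (s_comp \<phi>)) = 1"
proof -
  have child: "j \<noteq> i" "i = 0 \<or> j \<noteq> parent N i" if "j \<in> children N i" for j
    using that parent_not_self_or_child[OF assms] not_own_child[OF assms] by metis+
  have ne: "i \<noteq> 0 \<longrightarrow> parent N i \<noteq> i"
    using parent_not_self_or_child[OF assms] by auto
  have zero: "(\<Sum>j\<in>children N i. weight N i j (S_comp \<phi> \<psi>)) = 0"
    "(\<Sum>j\<in>children N i. weight N i j (l_comp \<phi> \<psi>)) = 0"
    "(\<Sum>j\<in>children N i. weight N i j (s_comp \<phi>)) = 0"
    by (intro sum.neutral ballI; simp add: child)+
  have one: "(\<Sum>j\<in>children N i. weight N i j (v_comp \<phi> \<psi>)) = (\<Sum>j\<in>children N i. 1)"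
    by (intro sum.cong refl) (simp add: child)
  show "(\<Sum>j\<in>nbrs N i. weight N i j (S_comp \<phi> \<psi>)) = 2 * card (children N i) + 3 + (if i = 0 then 0 else 1)"
    using ne by (simp add: sum_nbrs[OF assms] zero del: weight.simps) simp
  show "(\<Sum>j\<in>nbrs N i. weight N i j (l_comp \<phi> \<psi>)) = card (children N i) + 1 + (if i = 0 then 0 else 1)"
    using ne by (simp add: sum_nbrs[OF assms] zero del: weight.simps) simp
  show "(\<Sum>j\<in>nbrs N i. weight N i j (v_comp \<phi> \<psi>)) = card (children N i) + 2"
    using ne by (simp add: sum_nbrs[OF assms] one del: weight.simps) simp
  show "(\<Sum>j\<in>nbrs N i. weight N i j (s_comp \<phi>)) = 1"
    using ne by (simp add: sum_nbrs[OF assms] zero del: weight.simps) simp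
qed

definition centre_formula :: "net \<Rightarrow> nat \<Rightarrow> comp \<Rightarrow> input formula" where
  "centre_formula N i \<kappa> =
     Divide
       (formula_sum (nbrs N i) (\<lambda>j.
          Minus (Times (Lit (of_nat (weight N i j \<kappa>))) (Input (In_y j \<kappa>)))
                (Divide (Input (In_mu j \<kappa>)) (Input In_rho))))
       (Lit (of_nat (\<Sum>j\<in>nbrs N i. weight N i j \<kappa>)))"

lemma formula_val_centre:
  "formula_val P (input_val N r i c) (centre_formula N i \<kappa>) =
     weighted_centre (nbrs N i) (\<lambda>j. weight N i j \<kappa>) r
       (\<lambda>j. entry (cmu c j) \<kappa>) (\<lambda>j. entry (cy c j) \<kappa>)"
  by (simp add: centre_formula_def formula_val_sum finite_nbrs weighted_centre_def
      scaleR_conv_of_real[where 'a = complex] divide_inverse mult.commute del: of_nat_sum)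


text \<open>The unconstrained minimiser of the quadratic part of \<open>H0\<close>, entry by entry.\<close>

definition centre_point :: "net \<Rightarrow> real \<Rightarrow> nat \<Rightarrow> adm_data \<Rightarrow> bus_var" where
  "centre_point N r i c =
     make_x0 (\<lambda>\<kappa>. weighted_centre (nbrs N i) (\<lambda>j. weight N i j \<kappa>) r
       (\<lambda>j. entry (cmu c j) \<kappa>) (\<lambda>j. entry (cy c j) \<kappa>))"

text \<open>The weights depend only on the kind of a component, so the entrywise centres assemble to centres of
  whole matrices; the phases \<open>\<phi>\<close> and \<open>\<psi>\<close> merely pick one of the equal weights.\<close>

lemma centre_point_components:
  "Smat (centre_point N r i c) = weighted_centre (nbrs N i) (\<lambda>j. weight N i j (S_comp \<phi> \<psi>)) r
     (\<lambda>j. Smat (cmu c j)) (\<lambda>j. Smat (cy c j))"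
  "lmat (centre_point N r i c) = weighted_centre (nbrs N i) (\<lambda>j. weight N i j (l_comp \<phi> \<psi>)) r
     (\<lambda>j. lmat (cmu c j)) (\<lambda>j. lmat (cy c j))"
  "vmat (centre_point N r i c) = weighted_centre (nbrs N i) (\<lambda>j. weight N i j (v_comp \<phi> \<psi>)) r
     (\<lambda>j. vmat (cmu c j)) (\<lambda>j. vmat (cy c j))"
  "svec (centre_point N r i c) = weighted_centre (nbrs N i) (\<lambda>j. weight N i j (s_comp \<phi>)) r
     (\<lambda>j. svec (cmu c j)) (\<lambda>j. svec (cy c j))"
  by (simp_all add: centre_point_def make_x0_def vec_eq_iff weighted_centre_nth)

lemma y_space_subset: "y_space N i j \<subseteq> x0_space N i"
  by (auto simp: y_space_def)

lemma centre_point_in_x0_space: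
  assumes "c \<in> const_space N i"
  shows "centre_point N r i c \<in> x0_space N i"
proof -
  have "cy c j \<in> x0_space N i" "cmu c j \<in> x0_space N i" if "j \<in> nbrs N i" for j
    using assms that y_space_subset unfolding const_space_def by blast+
  then show ?thesis
    unfolding x0_space_def mem_Collect_eq
      centre_point_components(1-3)[where \<phi> = Ph_a and \<psi> = Ph_a]
      centre_point_components(4)[where \<phi> = Ph_a]
    by (intro conjI weighted_centre_in_subspace subspace_mats_on subspace_herms_on subspace_vecs_on)
      (auto simp: x0_space_def)
qed

definition block_of :: "bus_var \<Rightarrow> cmat6" where
  "block_of x = block (vmat x) (Smat x) (lmat x)"

text \<open>Both \<open>x\<close> and the centre are in \<open>x0_space N i\<close>, which is needed at the root: there the total weights of \<open>S\<close> and
  \<open>\<ell>\<close> are not in the ratio of the block matrix, but both components are zero.\<close>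

lemma H0_complete_square:
  assumes r: "r > 0" and N: "rooted_tree N" "i \<in> buses N" and c: "c \<in> const_space N i"
  shows "\<exists>C. \<forall>x \<in> x0_space N i. H0 N r i c x =
     bus_cost N i (svec x) + r / 2 * (norm (svec x - svec (centre_point N r i c)))\<^sup>2
     + r / 2 * ((real (card (children N i)) + 2) * (norm (block_of x - block_of (centre_point N r i c)))\<^sup>2)
     + C"
proof -
  let ?z = "centre_point N r i c" and ?J = "nbrs N i"
  define wS where "wS j = weight N i j (S_comp Ph_a Ph_a)" for j
  define wl where "wl j = weight N i j (l_comp Ph_a Ph_a)" for j
  define wv where "wv j = weight N i j (v_comp Ph_a Ph_a)" for j
  define ws where "ws j = weight N i j (s_comp Ph_a)" for j
  note w = wS_def wl_def wv_def ws_def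
  note W = sum_weights(1-3)[OF N, of Ph_a Ph_a, folded w] sum_weights(4)[OF N, of Ph_a, folded w]
  note z = centre_point_components(1-3)[of N r i c Ph_a Ph_a, folded w]
    centre_point_components(4)[of N r i c Ph_a, folded w]
  have summand: "pairing N i j (cmu c j) x + r / 2 * wdist2 N i j x (cy c j) =
      (Smat (cmu c j) \<bullet> Smat x + r / 2 * (real (wS j) * (norm (Smat x - Smat (cy c j)))\<^sup>2))
    + (lmat (cmu c j) \<bullet> lmat x + r / 2 * (real (wl j) * (norm (lmat x - lmat (cy c j)))\<^sup>2))
    + (vmat (cmu c j) \<bullet> vmat x + r / 2 * (real (wv j) * (norm (vmat x - vmat (cy c j)))\<^sup>2))
    + (svec (cmu c j) \<bullet> svec x + r / 2 * (real (ws j) * (norm (svec x - svec (cy c j)))\<^sup>2))"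
    if "j \<in> ?J" for j x
  proof -
    have "cmu c j \<in> y_space N i j" using c that by (simp add: const_space_def)
    then show ?thesis
      by (auto simp: y_space_def pairing_def wdist2_def w algebra_simps add_divide_distrib split: if_splits)
  qed
  obtain CS where CS: "\<And>x :: bus_var. (\<Sum>j\<in>?J. Smat (cmu c j) \<bullet> Smat x + r / 2 * (real (wS j) * (norm (Smat x - Smat (cy c j)))\<^sup>2))
      = r / 2 * (real (sum wS ?J) * (norm (Smat x - Smat ?z))\<^sup>2) + CS"
    by (rule that, unfold z, rule complete_square[OF r]) (simp add: W)
  obtain Cl where Cl: "\<And>x :: bus_var. (\<Sum>j\<in>?J. lmat (cmu c j) \<bullet> lmat x + r / 2 * (real (wl j) * (norm (lmat x - lmat (cy c j)))\<^sup>2))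
      = r / 2 * (real (sum wl ?J) * (norm (lmat x - lmat ?z))\<^sup>2) + Cl"
    by (rule that, unfold z, rule complete_square[OF r]) (simp add: W)
  obtain Cv where Cv: "\<And>x :: bus_var. (\<Sum>j\<in>?J. vmat (cmu c j) \<bullet> vmat x + r / 2 * (real (wv j) * (norm (vmat x - vmat (cy c j)))\<^sup>2))
      = r / 2 * (real (sum wv ?J) * (norm (vmat x - vmat ?z))\<^sup>2) + Cv"
    by (rule that, unfold z, rule complete_square[OF r]) (simp add: W)
  obtain Cs where Cs: "\<And>x :: bus_var. (\<Sum>j\<in>?J. svec (cmu c j) \<bullet> svec x + r / 2 * (real (ws j) * (norm (svec x - svec (cy c j)))\<^sup>2))
      = r / 2 * (real (sum ws ?J) * (norm (svec x - svec ?z))\<^sup>2) + Cs"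
    by (rule that, unfold z, rule complete_square[OF r]) (simp add: W)
  have "H0 N r i c x =
     bus_cost N i (svec x) + r / 2 * (norm (svec x - svec ?z))\<^sup>2
     + r / 2 * ((real (card (children N i)) + 2) * (norm (block_of x - block_of ?z))\<^sup>2)
     + (CS + Cl + Cv + Cs)" if x: "x \<in> x0_space N i" for x
  proof -
    have "H0 N r i c x = bus_cost N i (svec x)
        + (r / 2 * (real (sum wS ?J) * (norm (Smat x - Smat ?z))\<^sup>2) + CS
        + (r / 2 * (real (sum wl ?J) * (norm (lmat x - lmat ?z))\<^sup>2) + Cl)
        + (r / 2 * (real (sum wv ?J) * (norm (vmat x - vmat ?z))\<^sup>2) + Cv)
        + (r / 2 * (real (sum ws ?J) * (norm (svec x - svec ?z))\<^sup>2) + Cs))"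
      by (simp only: H0_def summand sum.distrib CS[unfolded sum.distrib] Cl[unfolded sum.distrib]
          Cv[unfolded sum.distrib] Cs[unfolded sum.distrib] cong: sum.cong)
    moreover have "i = 0 \<Longrightarrow> Smat x - Smat ?z = 0" "i = 0 \<Longrightarrow> lmat x - lmat ?z = 0"
      using x centre_point_in_x0_space[OF c, of r]
      by (simp_all add: x0_space_def line_phases_def mats_on_def herms_on_def vec_eq_iff)
    ultimately show ?thesis
      unfolding block_of_def block_diff square_norm_block W
      by (cases "i = 0") (simp_all add: algebra_simps)
  qed
  then show ?thesis by blast
qed

definition block_formula :: "net \<Rightarrow> nat \<Rightarrow> phase + phase \<Rightarrow> phase + phase \<Rightarrow> input formula" where
  "block_formula N i p q =
     (case p of
        Inl \<phi> \<Rightarrow> (case q of Inl \<psi> \<Rightarrow> centre_formula N i (v_comp \<phi> \<psi>)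
                         | Inr \<psi> \<Rightarrow> centre_formula N i (S_comp \<phi> \<psi>))
      | Inr \<phi> \<Rightarrow> (case q of Inl \<psi> \<Rightarrow> Conj (centre_formula N i (S_comp \<psi> \<phi>))
                         | Inr \<psi> \<Rightarrow> centre_formula N i (l_comp \<phi> \<psi>)))"

lemma formula_val_block:
  "(\<chi> p q. formula_val P (input_val N r i c) (block_formula N i p q)) = block_of (centre_point N r i c)"
  by (auto simp: vec_eq_iff block_formula_def block_of_def block_def adj_def centre_point_def make_x0_def
      formula_val_centre split: sum.split)

definition positive_part_formula :: "phase + phase \<Rightarrow> phase + phase \<Rightarrow> ('a + eig) formula" where
  "positive_part_formula p q =
     formula_sum UNIV (\<lambda>k.
       Times (Times (Maximum (Input (Inr (Eig_val k))) (Lit 0)) (Input (Inr (Eig_vec p k))))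
         (Conj (Input (Inr (Eig_vec q k)))))"

lemma formula_val_positive_part:
  "formula_val P (case_sum env (eig_entry d U)) (positive_part_formula p q) =
     spectral_sum U (\<lambda>k. max (d k) 0) $ p $ q"
  by (simp add: positive_part_formula_def formula_val_sum spectral_sum_def)

primrec x0_formula :: "net \<Rightarrow> nat \<Rightarrow> comp \<Rightarrow> (input + eig) formula" where
  "x0_formula N i (S_comp \<phi> \<psi>) = positive_part_formula (Inl \<phi>) (Inr \<psi>)"
| "x0_formula N i (l_comp \<phi> \<psi>) = positive_part_formula (Inr \<phi>) (Inr \<psi>)"
| "x0_formula N i (v_comp \<phi> \<psi>) = positive_part_formula (Inl \<phi>) (Inl \<psi>)"
| "x0_formula N i (s_comp \<phi>) =
     (if \<phi> \<in> phases N i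
      then Solve \<phi> (Input (Inl In_rho)) (map_formula Inl (centre_formula N i (s_comp \<phi>)))
      else Lit 0)"

lemma x0_formula_value:
  fixes U :: cmat6
  shows "make_x0 (\<lambda>k. formula_val P (case_sum (input_val N r i c) (eig_entry d U)) (x0_formula N i k)) =
    (let X = spectral_sum U (\<lambda>k. max (d k) 0) in
     \<lparr>Smat = upper_right X, lmat = lower_right X, vmat = upper_left X,
      svec = (\<chi> \<phi>. if \<phi> \<in> phases N i then P \<phi> r (svec (centre_point N r i c) $ \<phi>) else 0)\<rparr>)"
  by (auto simp: make_x0_def Let_def formula_val_positive_part upper_right_def lower_right_def upper_left_def
      vec_eq_iff formula_val_map_Inl formula_val_centre centre_point_def)

lemma scalar_part_minimal:
  assumes "r > 0" and P: "\<And>\<phi>. \<phi> \<in> phases N i \<Longrightarrow>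
      is_arg_min (\<lambda>s. cost N i \<phi> s + r / 2 * (cmod (s - t $ \<phi>))\<^sup>2) (\<lambda>s. s \<in> region N i \<phi>) (u $ \<phi>)"
    and "t \<in> vecs_on (phases N i)" "u \<in> vecs_on (phases N i)" "s \<in> vecs_on (phases N i)"
    and s: "\<And>\<phi>. \<phi> \<in> phases N i \<Longrightarrow> s $ \<phi> \<in> region N i \<phi>"
  shows "bus_cost N i u + r / 2 * (norm (u - t))\<^sup>2 \<le> bus_cost N i s + r / 2 * (norm (s - t))\<^sup>2"
proof -
  have split: "bus_cost N i a + r / 2 * (norm (a - t))\<^sup>2 =
      (\<Sum>\<phi>\<in>phases N i. cost N i \<phi> (a $ \<phi>) + r / 2 * (cmod (a $ \<phi> - t $ \<phi>))\<^sup>2)"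
    if a: "a \<in> vecs_on (phases N i)" for a
  proof -
    have "(norm (a - t))\<^sup>2 = (\<Sum>\<phi>\<in>UNIV. (cmod (a $ \<phi> - t $ \<phi>))\<^sup>2)"
      by (simp add: norm_vec_def L2_set_def sum_nonneg)
    also have "\<dots> = (\<Sum>\<phi>\<in>phases N i. (cmod (a $ \<phi> - t $ \<phi>))\<^sup>2)"
      using a assms(3) by (intro sum.mono_neutral_right) (auto simp: vecs_on_def)
    finally show ?thesis
      by (simp add: bus_cost_def sum.distrib sum_distrib_left)
  qed
  show ?thesis
    unfolding split[OF assms(4)] split[OF assms(5)]
    using P s by (intro sum_mono) (auto simp: is_arg_min_linorder)
qed

lemma x0_subproblem_solvable:
  assumes r: "r > 0" and N: "opf_net N" and P: "scalar_solver N P" and i: "i \<in> buses N"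
  shows "eigen_solvable (P i) (const_space N i) (input_val N r i) make_x0 (H0 N r i) (K0 N i)"
proof -
  have optimal: "is_arg_min (H0 N r i c) (\<lambda>x. x \<in> K0 N i)
      (make_x0 (\<lambda>k. formula_val (P i) (case_sum (input_val N r i c) (eig_entry d U)) (x0_formula N i k)))"
    if c: "c \<in> const_space N i"
      and eig: "eigen_decomposition (block_of (centre_point N r i c)) d U" for c d U
  proof -
    let ?z = "centre_point N r i c"
    define X where "X = spectral_sum U (\<lambda>k. max (d k) 0)"
    define x where "x = \<lparr>Smat = upper_right X, lmat = lower_right X, vmat = upper_left X,
        svec = (\<chi> \<phi>. if \<phi> \<in> phases N i then P i \<phi> r (svec ?z $ \<phi>) else 0)\<rparr>"
    have z: "?z \<in> x0_space N i" by (rule centre_point_in_x0_space[OF c])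
    have tree: "rooted_tree N" using N by (simp add: opf_net_def)
    have X: "hermitian X" "psd X"
      unfolding X_def by (simp_all add: hermitian_spectral_sum psd_spectral_sum)
    have block_x: "block_of x = X"
      by (simp add: block_of_def x_def block_of_parts[OF X(1)])
    \<comment> \<open>Zero padding of the centre carries over to its projection.\<close>
    have row_v: "block_of ?z $ Inl \<phi> $ q = 0" if "\<phi> \<notin> phases N i" for \<phi> q
      using z that by (auto simp: block_of_def block_def x0_space_def mats_on_def herms_on_def line_phases_def
          split: sum.split if_splits)
    have row_l: "block_of ?z $ Inr \<phi> $ q = 0" if "\<phi> \<notin> line_phases N i" for \<phi> q
      using z that by (auto simp: block_of_def block_def x0_space_def mats_on_def herms_on_def adj_def
          split: sum.split)
    have zero_v: "X $ Inl \<phi> $ q = 0" "X $ q $ Inl \<phi> = 0" if "\<phi> \<notin> phases N i" for \<phi> q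
      unfolding X_def using positive_part_zero_row[OF eig row_v[OF that]] by blast+
    have zero_l: "X $ Inr \<phi> $ q = 0" "X $ q $ Inr \<phi> = 0" if "\<phi> \<notin> line_phases N i" for \<phi> q
      unfolding X_def using positive_part_zero_row[OF eig row_l[OF that]] by blast+
    have solver: "is_arg_min (\<lambda>s. cost N i \<phi> s + r / 2 * (cmod (s - svec ?z $ \<phi>))\<^sup>2)
        (\<lambda>s. s \<in> region N i \<phi>) (svec x $ \<phi>)" if "\<phi> \<in> phases N i" for \<phi>
      using P r i that by (simp add: scalar_solver_def x_def)
    have "Smat x \<in> mats_on (line_phases N i)"
      using zero_v zero_l by (auto simp: x_def mats_on_def upper_right_def line_phases_def split: if_splits)
    then have space: "x \<in> x0_space N i"
      using zero_v zero_l hermitian_parts[OF X(1)]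
      by (auto simp: x0_space_def x_def mats_on_def herms_on_def vecs_on_def
          upper_left_def upper_right_def lower_right_def)
    have feasible: "x \<in> K0 N i"
      using space solver block_x X(2) by (auto simp: K0_def block_of_def is_arg_min_def)
    obtain C where C: "\<And>x. x \<in> x0_space N i \<Longrightarrow> H0 N r i c x =
       bus_cost N i (svec x) + r / 2 * (norm (svec x - svec ?z))\<^sup>2
       + r / 2 * ((real (card (children N i)) + 2) * (norm (block_of x - block_of ?z))\<^sup>2) + C"
      using H0_complete_square[OF r tree i c] by blast
    have "H0 N r i c x \<le> H0 N r i c y" if y: "y \<in> K0 N i" for y
    proof -
      have ys: "y \<in> x0_space N i" "psd (block_of y)" "\<And>\<phi>. \<phi> \<in> phases N i \<Longrightarrow> svec y $ \<phi> \<in> region N i \<phi>"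
        using y by (simp_all add: K0_def block_of_def)
      have "norm (block_of x - block_of ?z) \<le> norm (block_of y - block_of ?z)"
        unfolding block_x X_def by (rule positive_part_nearest_psd[OF eig ys(2)])
      then have "r / 2 * ((real (card (children N i)) + 2) * (norm (block_of x - block_of ?z))\<^sup>2)
          \<le> r / 2 * ((real (card (children N i)) + 2) * (norm (block_of y - block_of ?z))\<^sup>2)"
        using r by (intro mult_left_mono power_mono) auto
      moreover have "bus_cost N i (svec x) + r / 2 * (norm (svec x - svec ?z))\<^sup>2
          \<le> bus_cost N i (svec y) + r / 2 * (norm (svec y - svec ?z))\<^sup>2"
        using z space ys by (intro scalar_part_minimal[OF r solver]) (auto simp: x0_space_def)
      ultimately show ?thesis
        unfolding C[OF space] C[OF ys(1)] by linarith
    qed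
    then have "is_arg_min (H0 N r i c) (\<lambda>x. x \<in> K0 N i) x"
      using feasible by (simp add: is_arg_min_linorder)
    then show ?thesis
      unfolding x0_formula_value Let_def X_def[symmetric] x_def[symmetric] .
  qed
  have herm: "hermitian (block_of (centre_point N r i c))" if "c \<in> const_space N i" for c
    using centre_point_in_x0_space[OF that, of r]
    unfolding block_of_def x0_space_def herms_on_def by (intro hermitian_block) auto
  show ?thesis
    unfolding eigen_solvable_def
    by (rule exI[of _ "block_formula N i"], rule exI[of _ "x0_formula N i"])
      (simp add: formula_val_block herm hermitian_eigen_decomposition optimal)
qed

section \<open>The subproblem for the second block of variables\<close>

definition voltage_centre_formula :: "nat \<Rightarrow> phase \<Rightarrow> phase \<Rightarrow> input formula" where
  "voltage_centre_formula i \<phi> \<psi> =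
     Minus (Input (In_y i (v_comp \<phi> \<psi>))) (Divide (Input (In_lam \<phi> \<psi>)) (Input In_rho))"

definition x1_formula :: "net \<Rightarrow> nat \<Rightarrow> phase \<times> phase \<Rightarrow> input formula" where
  "x1_formula N i = (\<lambda>(\<phi>, \<psi>).
     if \<phi> = \<psi> \<and> \<phi> \<in> phases N i
     then Maximum (Input (In_vmin \<phi>)) (Minimum (Input (In_vmax \<phi>)) (voltage_centre_formula i \<phi> \<psi>))
     else voltage_centre_formula i \<phi> \<psi>)"

text \<open>The diagonal entries of a Hermitian matrix are real, so clamping the real part of the centre's diagonal entry
  gives the point of the interval nearest to it.\<close>

lemma x1_subproblem_solvable:
  assumes r: "r > 0" and N: "opf_net N" and i: "i \<in> buses N"
  shows "closed_form_solvable P (const_space N i) (input_val N r i) make_x1 (H1 N r i) (K1 N i)"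
  unfolding closed_form_solvable_def
proof (intro exI ballI)
  fix c assume c: "c \<in> const_space N i"
  define t where "t = vmat (cy c i) - (1 / r) *\<^sub>R clam c"
  define v where "v = make_x1 (\<lambda>k. formula_val P (input_val N r i c) (x1_formula N i k))"
  have bounds: "vmin N i \<phi> \<le> vmax N i \<phi>" if "\<phi> \<in> phases N i" for \<phi>
    using N i that by (simp add: opf_net_def)
  have "cy c i \<in> x0_space N i"
    using c by (simp add: const_space_def nbrs_def y_space_def)
  then have t: "t \<in> herms_on (phases N i)"
    using c unfolding t_def x0_space_def const_space_def
    by (auto intro!: subspace_diff subspace_scale subspace_herms_on)
  have t_nth: "formula_val P (input_val N r i c) (voltage_centre_formula i \<phi> \<psi>) = t $ \<phi> $ \<psi>"
    for \<phi> \<psi>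
    by (simp add: voltage_centre_formula_def t_def scaleR_conv_of_real[where 'a = complex])
  have v_nth: "v $ \<phi> $ \<psi> =
     (if \<phi> = \<psi> \<and> \<phi> \<in> phases N i
      then complex_of_real (max (vmin N i \<phi>) (min (vmax N i \<phi>) (Re (t $ \<phi> $ \<psi>))))
      else t $ \<phi> $ \<psi>)" for \<phi> \<psi>
    by (auto simp: v_def make_x1_def x1_formula_def t_nth)
  have feasible: "v \<in> K1 N i"
    using t bounds unfolding K1_def herms_on_def mats_on_def hermitian_def adj_def
    by (auto simp: v_nth vec_eq_iff)
  have "H1 N r i c v \<le> H1 N r i c w" if w: "w \<in> K1 N i" for w
  proof -
    have Im_diag: "Im (A $ \<phi> $ \<phi>) = 0" if "A \<in> herms_on (phases N i)" for A \<phi>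
    proof -
      have "cnj (A $ \<phi> $ \<phi>) = A $ \<phi> $ \<phi>"
        using that by (simp add: herms_on_def hermitian_def adj_def vec_eq_iff)
      then show ?thesis by (simp add: complex_eq_iff)
    qed
    have entry: "cmod (v $ \<phi> $ \<psi> - t $ \<phi> $ \<psi>) \<le> cmod (w $ \<phi> $ \<psi> - t $ \<phi> $ \<psi>)" for \<phi> \<psi>
    proof (cases "\<phi> = \<psi> \<and> \<phi> \<in> phases N i")
      case True
      have "Im (w $ \<phi> $ \<phi>) = 0" "Im (t $ \<phi> $ \<phi>) = 0"
        using Im_diag t w by (auto simp: K1_def)
      moreover have "vmin N i \<phi> \<le> Re (w $ \<phi> $ \<phi>)" "Re (w $ \<phi> $ \<phi>) \<le> vmax N i \<phi>"
        using w True by (auto simp: K1_def)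
      ultimately show ?thesis
        using True by (simp add: v_nth cmod_def) linarith
    qed (auto simp: v_nth)
    have "(norm (v - t))\<^sup>2 \<le> (norm (w - t))\<^sup>2"
      unfolding power2_norm_eq_inner inner_vec_def
      by (intro sum_mono) (simp add: power2_norm_eq_inner[symmetric] entry power_mono)
    moreover have "H1 N r i c w = r / 2 * (norm (w - t))\<^sup>2
        + (r / 2 * ((norm (vmat (cy c i)))\<^sup>2 - (norm t)\<^sup>2))" for w
    proof -
      have lam: "clam c = r *\<^sub>R (vmat (cy c i) - t)" using r by (simp add: t_def)
      show ?thesis
        unfolding H1_def lam
        by (simp add: power2_norm_eq_inner inner_diff_left inner_diff_right inner_commute algebra_simps)
    qed
    ultimately show ?thesis using r by simp
  qed
  then show "is_arg_min (H1 N r i c) (\<lambda>v. v \<in> K1 N i)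
      (make_x1 (\<lambda>k. formula_val P (input_val N r i c) (x1_formula N i k)))"
    unfolding v_def[symmetric] using feasible by (simp add: is_arg_min_linorder)
qed

section \<open>Solvability of the subproblems\<close>

theorem mainTheorem1:
  fixes N :: net and \<rho> :: real
    and P :: "nat \<Rightarrow> phase \<Rightarrow> real \<Rightarrow> complex \<Rightarrow> complex"
  assumes "\<rho> > 0"
    and "opf_net N"
    and "scalar_solver N P"
  shows "\<forall>i \<in> buses N.
      solvable (P i) (const_space N i) (input_val N \<rho> i) make_x0 (H0 N \<rho> i) (K0 N i) \<and>
      solvable (P i) (const_space N i) (input_val N \<rho> i) make_x1 (H1 N \<rho> i) (K1 N i)"
  unfolding solvable_def
  using x0_subproblem_solvable[OF assms] x1_subproblem_solvable[OF assms(1,2)] by blast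

end
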